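(* Let $E$ and $F$ be Banach lattices such that $E$ or $F$ is order continuous. Then every positive $M$-weakly compact operator $T\colon E\to F$ is $uaw$-Dunford-Pettis.
   Context: A net $(x_\alpha)$ in a Banach lattice $E$ is $uaw$-convergent to $x$ if $|x_\alpha-x|\wedge u\to 0$ weakly for every $u\in E_+$. A bounded operator $T\colon E\to F$ is $uaw$-Dunford-Pettis if every norm bounded $uaw$-null sequence $(x_n)$ in $E$ satisfies $\|Tx_n\|\to 0$, and $M$-weakly compact if $\|Tx_n\|\to0$ for every norm bounded disjoint sequence $(x_n)$ in $E$. *)

theory Defs
  imports "HOL-Analysis.Analysis"
begin

definition lmod :: "'a::{lattice, uminus} \<Rightarrow> 'a" where
  "lmod x = sup x (- x)"

class banach_lattice = banach + ordered_real_vector + lattice +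
  assumes lattice_norm: "sup x (- x) \<le> sup y (- y) \<Longrightarrow> norm x \<le> norm y"

definition weakly_null :: "(nat \<Rightarrow> 'a::real_normed_vector) \<Rightarrow> bool" where
  "weakly_null x \<longleftrightarrow>
     (\<forall>f::'a \<Rightarrow> real. bounded_linear f \<longrightarrow> (\<lambda>n. f (x n)) \<longlonglongrightarrow> 0)"

definition uaw_null :: "(nat \<Rightarrow> 'a::banach_lattice) \<Rightarrow> bool" where
  "uaw_null x \<longleftrightarrow> (\<forall>u. 0 \<le> u \<longrightarrow> weakly_null (\<lambda>n. inf (lmod (x n)) u))"

definition norm_bounded_seq :: "(nat \<Rightarrow> 'a::real_normed_vector) \<Rightarrow> bool" where
  "norm_bounded_seq x \<longleftrightarrow> (\<exists>C. \<forall>n. norm (x n) \<le> C)"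

definition disjoint_seq :: "(nat \<Rightarrow> 'a::banach_lattice) \<Rightarrow> bool" where
  "disjoint_seq x \<longleftrightarrow> (\<forall>n m. n \<noteq> m \<longrightarrow> inf (lmod (x n)) (lmod (x m)) = 0)"

text \<open>Order continuous norm: x_\<alpha> \<down> 0 implies \<parallel>x_\<alpha>\<parallel> \<rightarrow> 0.  A decreasing net
  with infimum 0 is rendered as a nonempty downward directed set D whose
  infimum is 0 (the net indexed by D itself); since the norm is monotone
  on positive elements, \<parallel>x_\<alpha>\<parallel> \<rightarrow> 0 means inf of norms over D is 0.\<close>
definition order_continuous :: "'a::banach_lattice itself \<Rightarrow> bool" where
  "order_continuous _ \<longleftrightarrow>
     (\<forall>D::'a set. D \<noteq> {} \<longrightarrow>
        (\<forall>x\<in>D. \<forall>y\<in>D. \<exists>z\<in>D. z \<le> x \<and> z \<le> y) \<longrightarrow>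
        (\<forall>x\<in>D. 0 \<le> x) \<longrightarrow>
        (\<forall>l. (\<forall>x\<in>D. l \<le> x) \<longrightarrow> l \<le> 0) \<longrightarrow>
        (\<forall>e>0. \<exists>x\<in>D. norm x < e))"

definition positive_operator :: "('a::banach_lattice \<Rightarrow> 'b::banach_lattice) \<Rightarrow> bool" where
  "positive_operator T \<longleftrightarrow> (\<forall>x. 0 \<le> x \<longrightarrow> 0 \<le> T x)"

definition M_weakly_compact :: "('a::banach_lattice \<Rightarrow> 'b::banach_lattice) \<Rightarrow> bool" where
  "M_weakly_compact T \<longleftrightarrow> bounded_linear T \<and>
     (\<forall>x. norm_bounded_seq x \<longrightarrow> disjoint_seq x \<longrightarrow> (\<lambda>n. norm (T (x n))) \<longlonglongrightarrow> 0)"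

definition uaw_Dunford_Pettis :: "('a::banach_lattice \<Rightarrow> 'b::banach_lattice) \<Rightarrow> bool" where
  "uaw_Dunford_Pettis T \<longleftrightarrow> bounded_linear T \<and>
     (\<forall>x. norm_bounded_seq x \<longrightarrow> uaw_null x \<longrightarrow> (\<lambda>n. norm (T (x n))) \<longlonglongrightarrow> 0)"

end

(* For positive M-weakly compact T and e > 0 there is u >= 0 such that T (|x_n| - u)^+ has norm at
   most e for all n: otherwise a gliding hump argument extracts a norm bounded disjoint sequence whose image
   does not tend to 0. It remains to treat T (|x_n| inf u), which is positive, order bounded and
   weakly null, already before applying T.

   In an order continuous Banach lattice such a sequence (y_n) is norm null. Otherwise choose
   positive functionals f_k norming y_k (Hahn-Banach for the sublinear functional |x^+|) and pass to
   a subsequence along which f_k (y_n) is tiny for all k < n. Then the positive parts of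
   y_k - (1/d) * (sum of the later y_n) - d u are disjoint and order bounded, while f_k keeps their
   norms away from 0, which contradicts order continuity. If E is order continuous, this is applied
   to |x_n| inf u, and if F is, to its image under T. *)

theory Submission
  imports Defs "HOL-Library.Lattice_Algebras"
begin

section \<open>Linear functionals below sublinear functionals\<close>

text \<open>Homogeneity is only an inequality, which is easier to verify for infima; scaling back by
  1/c gives equality for c > 0.\<close>

definition sublinear :: "('a::real_vector \<Rightarrow> real) \<Rightarrow> bool" where
  "sublinear p \<longleftrightarrow> (\<forall>x y. p (x + y) \<le> p x + p y) \<and> (\<forall>c x. 0 \<le> c \<longrightarrow> p (c *\<^sub>R x) \<le> c * p x)"

lemma sublinear_add: "sublinear p \<Longrightarrow> p (x + y) \<le> p x + p y"
  by (simp add: sublinear_def)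

lemma sublinear_scaleR_le: "sublinear p \<Longrightarrow> 0 \<le> c \<Longrightarrow> p (c *\<^sub>R x) \<le> c * p x"
  by (simp add: sublinear_def)

lemma sublinear_scaleR:
  assumes p: "sublinear p" and c: "0 \<le> c"
  shows "p (c *\<^sub>R x) = c * p x"
proof (cases "c = 0")
  case True
  have "p (0 + 0) \<le> p 0 + p 0" by (rule sublinear_add[OF p])
  moreover have "p (0 *\<^sub>R 0) \<le> 0 * p 0" by (rule sublinear_scaleR_le[OF p]) simp
  ultimately show ?thesis using True by simp
next
  case False
  have "p ((1/c) *\<^sub>R (c *\<^sub>R x)) \<le> (1/c) * p (c *\<^sub>R x)"
    by (rule sublinear_scaleR_le[OF p]) (use c in simp)
  then have "c * p x \<le> p (c *\<^sub>R x)" using False c by (simp add: field_simps)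
  with sublinear_scaleR_le[OF p c] show ?thesis by (simp add: antisym)
qed

lemma sublinear_zero: "sublinear p \<Longrightarrow> p 0 = 0"
  using sublinear_scaleR[of p 0 0] by simp

lemma sublinear_minus_ge: "sublinear p \<Longrightarrow> - p (- x) \<le> p x"
  using sublinear_add[of p x "- x"] sublinear_zero[of p] by simp

text \<open>The largest sublinear functional below q whose value at - a is at most - q a.\<close>
definition slope :: "('a::real_vector \<Rightarrow> real) \<Rightarrow> 'a \<Rightarrow> 'a \<Rightarrow> real" where
  "slope q a x = (INF t\<in>{0..}. q (x + t *\<^sub>R a) - t * q a)"

lemma bdd_below_slope:
  assumes q: "sublinear q"
  shows "bdd_below ((\<lambda>t. q (x + t *\<^sub>R a) - t * q a) ` {0..})"
proof (rule bdd_belowI2)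
  fix t :: real assume t: "t \<in> {0..}"
  have "q ((x + t *\<^sub>R a) + (- x)) \<le> q (x + t *\<^sub>R a) + q (- x)" by (rule sublinear_add[OF q])
  then show "- q (- x) \<le> q (x + t *\<^sub>R a) - t * q a"
    using sublinear_scaleR[OF q, of t a] t by simp
qed

lemma slope_le:
  assumes q: "sublinear q" and t: "0 \<le> t"
  shows "slope q a x \<le> q (x + t *\<^sub>R a) - t * q a"
  unfolding slope_def by (rule cINF_lower[OF bdd_below_slope[OF q]]) (use t in simp)

lemma slope_greatest:
  "(\<And>t. 0 \<le> t \<Longrightarrow> m \<le> q (x + t *\<^sub>R a) - t * q a) \<Longrightarrow> m \<le> slope q a x"
  unfolding slope_def by (rule cINF_greatest) auto

lemma slope_le_self: "sublinear q \<Longrightarrow> slope q a x \<le> q x"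
  using slope_le[of q 0] by simp

lemma slope_uminus_le: "sublinear q \<Longrightarrow> slope q a (- a) \<le> - q a"
  using slope_le[of q 1 a "- a"] sublinear_zero[of q] by simp

lemma sublinear_slope:
  assumes q: "sublinear q"
  shows "sublinear (slope q a)"
  unfolding sublinear_def
proof (intro conjI allI impI)
  fix x y
  \<comment> \<open>The parameters s for x and t for y merge into the single parameter s + t, so the
    two infima can then be taken one after the other.\<close>
  have *: "slope q a (x + y) \<le> (q (x + s *\<^sub>R a) - s * q a) + (q (y + t *\<^sub>R a) - t * q a)"
    if "0 \<le> s" "0 \<le> t" for s t
  proof -
    have "slope q a (x + y) \<le> q ((x + y) + (s + t) *\<^sub>R a) - (s + t) * q a"
      by (rule slope_le[OF q]) (use that in simp)
    also have "(x + y) + (s + t) *\<^sub>R a = (x + s *\<^sub>R a) + (y + t *\<^sub>R a)"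
      by (simp add: algebra_simps)
    also have "q \<dots> \<le> q (x + s *\<^sub>R a) + q (y + t *\<^sub>R a)" by (rule sublinear_add[OF q])
    finally show ?thesis by (simp add: algebra_simps)
  qed
  have "slope q a (x + y) - slope q a y \<le> slope q a x"
  proof (rule slope_greatest)
    fix s :: real assume s: "0 \<le> s"
    have "slope q a (x + y) - (q (x + s *\<^sub>R a) - s * q a) \<le> slope q a y"
      by (rule slope_greatest) (use *[OF s] in force)
    then show "slope q a (x + y) - slope q a y \<le> q (x + s *\<^sub>R a) - s * q a" by simp
  qed
  then show "slope q a (x + y) \<le> slope q a x + slope q a y" by simp
next
  fix c :: real and x assume c: "0 \<le> c"
  show "slope q a (c *\<^sub>R x) \<le> c * slope q a x"
  proof (cases "c = 0")
    case True
    then show ?thesis using slope_le_self[OF q, of a 0] sublinear_zero[OF q] by simp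
  next
    case False
    with c have c': "0 < c" by simp
    have "slope q a (c *\<^sub>R x) / c \<le> slope q a x"
    proof (rule slope_greatest)
      fix t :: real assume t: "0 \<le> t"
      have "slope q a (c *\<^sub>R x) \<le> q (c *\<^sub>R x + (c * t) *\<^sub>R a) - (c * t) * q a"
        by (rule slope_le[OF q]) (use c t in simp)
      also have "c *\<^sub>R x + (c * t) *\<^sub>R a = c *\<^sub>R (x + t *\<^sub>R a)" by (simp add: algebra_simps)
      also have "q \<dots> = c * q (x + t *\<^sub>R a)" by (rule sublinear_scaleR[OF q c])
      finally show "slope q a (c *\<^sub>R x) / c \<le> q (x + t *\<^sub>R a) - t * q a"
        using c' by (simp add: field_simps)
    qed
    then show ?thesis using c' by (simp add: field_simps)
  qed
qed

text \<open>The pointwise infimum works. It is finite because every q below p satisfies q x >= - q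
  (- x) >= - p (- x), and it is subadditive because the smaller of two members of the chain serves
  both arguments.\<close>

lemma sublinear_chain_lower_bound:
  assumes C: "C \<noteq> {}" and sub: "\<And>q. q \<in> C \<Longrightarrow> sublinear q \<and> q \<le> p"
    and chain: "\<And>q r. q \<in> C \<Longrightarrow> r \<in> C \<Longrightarrow> q \<le> r \<or> r \<le> q"
  shows "\<exists>m. sublinear m \<and> (\<forall>q\<in>C. m \<le> q)"
proof -
  define m where "m x = (INF q\<in>C. q x)" for x
  have bdd: "bdd_below ((\<lambda>q. q x) ` C)" for x
  proof (rule bdd_belowI2)
    fix q assume "q \<in> C"
    then have "sublinear q" "q (- x) \<le> p (- x)" using sub by (auto simp: le_fun_def)
    then show "- p (- x) \<le> q x" using sublinear_minus_ge[of q x] by simp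
  qed
  have low: "m x \<le> q x" if "q \<in> C" for q x
    unfolding m_def by (rule cINF_lower[OF bdd that])
  have great: "k \<le> m x" if "\<And>q. q \<in> C \<Longrightarrow> k \<le> q x" for k x
    unfolding m_def by (rule cINF_greatest[OF C that])
  have "sublinear m" unfolding sublinear_def
  proof (intro conjI allI impI)
    fix x y
    have *: "m (x + y) \<le> q x + r y" if qr: "q \<in> C" "r \<in> C" for q r
      using chain[OF qr]
    proof
      assume "q \<le> r"
      then show ?thesis
        using low[OF qr(1), of "x + y"] sublinear_add[of q x y] sub[OF qr(1)]
        by (smt (verit) le_funD)
    next
      assume "r \<le> q"
      then show ?thesis
        using low[OF qr(2), of "x + y"] sublinear_add[of r x y] sub[OF qr(2)]
        by (smt (verit) le_funD)
    qed
    have "m (x + y) - m y \<le> m x"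
    proof (rule great)
      fix q assume q: "q \<in> C"
      have "m (x + y) - q x \<le> m y" by (rule great) (use *[OF q] in force)
      then show "m (x + y) - m y \<le> q x" by simp
    qed
    then show "m (x + y) \<le> m x + m y" by simp
  next
    fix c :: real and x assume c: "0 \<le> c"
    show "m (c *\<^sub>R x) \<le> c * m x"
    proof (cases "c = 0")
      case True
      obtain q where q: "q \<in> C" using C by blast
      have "q 0 = 0" using sub[OF q] sublinear_zero by blast
      with True low[OF q, of 0] show ?thesis by simp
    next
      case False
      with c have c': "0 < c" by simp
      have "m (c *\<^sub>R x) / c \<le> m x"
      proof (rule great)
        fix q assume q: "q \<in> C"
        have "m (c *\<^sub>R x) \<le> c * q x"
          using low[OF q, of "c *\<^sub>R x"] sublinear_scaleR_le[OF _ c, of q x] sub[OF q] by simp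
        then show "m (c *\<^sub>R x) / c \<le> q x" using c' by (simp add: field_simps)
      qed
      then show ?thesis using c' by (simp add: field_simps)
    qed
  qed
  with low show ?thesis by (auto simp: le_fun_def)
qed

text \<open>A minimal sublinear functional below p cannot be lowered by any \<open>slope\<close>.
  Equality with all its slopes makes it odd, and an odd sublinear functional is linear.\<close>

lemma exists_linear_below_sublinear:
  assumes p: "sublinear p"
  shows "\<exists>f. linear f \<and> (\<forall>x. f x \<le> p x)"
proof -
  define A where "A = {q. sublinear q \<and> q \<le> p}"
  \<comment> \<open>Zorn's lemma is used for the reversed pointwise order, so its maximal element is
    a minimal functional.\<close>
  have "\<exists>m\<in>A. \<forall>a\<in>A. a \<le> m \<longrightarrow> a = m"
  proof (rule predicate_Zorn)
    show "partial_order_on A (relation_of (\<lambda>x y. y \<le> x) A)"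
      by (rule partial_order_on_relation_ofI) auto
    fix C assume C: "C \<in> Chains (relation_of (\<lambda>x y. y \<le> x) A)"
    show "\<exists>u\<in>A. \<forall>a\<in>C. u \<le> a"
    proof (cases "C = {}")
      case True
      then show ?thesis using p by (auto simp: A_def)
    next
      case False
      have CA: "C \<subseteq> A" using C by (auto simp: Chains_def relation_of_def)
      obtain m where m: "sublinear m" "\<forall>q\<in>C. m \<le> q"
        using sublinear_chain_lower_bound[OF False, of p] C CA
        by (auto simp: Chains_def relation_of_def A_def)
      moreover obtain q where "q \<in> C" using False by blast
      ultimately have "m \<le> p" using CA by (force simp: A_def intro: order_trans)
      then show ?thesis using m by (auto simp: A_def)
    qed
  qed
  then obtain q where q: "sublinear q" "q \<le> p"
    and minimal: "\<And>a. sublinear a \<Longrightarrow> a \<le> p \<Longrightarrow> a \<le> q \<Longrightarrow> a = q"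
    by (auto simp: A_def)
  have "slope q a = q" for a
  proof (rule minimal)
    show "slope q a \<le> q" using slope_le_self[OF q(1)] by (simp add: le_fun_def)
    then show "slope q a \<le> p" using q(2) by (rule order_trans)
  qed (rule sublinear_slope[OF q(1)])
  then have minus: "q (- a) = - q a" for a
    using slope_uminus_le[OF q(1), of a] sublinear_minus_ge[OF q(1), of "- a"] by simp
  have "linear q"
  proof (rule linearI)
    fix x y
    show "q (x + y) = q x + q y"
      using sublinear_add[OF q(1), of x y] sublinear_add[OF q(1), of "- x" "- y"]
        minus[of x] minus[of y] minus[of "x + y"] by simp
  next
    fix c :: real and x
    show "q (c *\<^sub>R x) = c *\<^sub>R q x"
    proof (cases "0 \<le> c")
      case True
      then show ?thesis by (simp add: sublinear_scaleR[OF q(1)])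
    next
      case False
      then have "q ((- c) *\<^sub>R x) = (- c) * q x" by (intro sublinear_scaleR[OF q(1)]) simp
      then show ?thesis using minus[of "c *\<^sub>R x"] by simp
    qed
  qed
  then show ?thesis using q(2) by (auto simp: le_fun_def)
qed

text \<open>A linear f below \<open>slope p y\<close> is below p, and its value at - y is at most -
  p y, which forces equality at y.\<close>

lemma exists_linear_support_sublinear:
  assumes p: "sublinear p"
  shows "\<exists>f. linear f \<and> (\<forall>x. f x \<le> p x) \<and> f y = p y"
proof -
  obtain f where f: "linear f" "\<And>x. f x \<le> slope p y x"
    using exists_linear_below_sublinear[OF sublinear_slope[OF p]] by blast
  then have le: "f x \<le> p x" for x using slope_le_self[OF p, of y x] by (meson order_trans)
  have "f (- y) \<le> - p y" using f(2) slope_uminus_le[OF p, of y] by (meson order_trans)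
  then have "f y = p y" using le[of y] linear_neg[OF f(1), of y] by simp
  with f(1) le show ?thesis by blast
qed

section \<open>Banach lattices\<close>

text \<open>Brings in the theory of lattice-ordered groups, in particular
  \<open>pprt\<close>.\<close>

instance banach_lattice \<subseteq> lattice_ab_group_add ..

lemma lmod_of_nonneg: "0 \<le> x \<Longrightarrow> lmod x = x" for x :: "'a::banach_lattice"
  by (simp add: lmod_def sup_absorb1 order_trans[of "- x" 0 x])

lemma lmod_nonneg: "0 \<le> lmod x" for x :: "'a::banach_lattice"
proof -
  have "x + (- x) \<le> lmod x + lmod x" by (intro add_mono) (auto simp: lmod_def)
  then show ?thesis by simp
qed

lemma le_lmod: "x \<le> lmod x" and neg_le_lmod: "- x \<le> lmod x" for x :: "'a::banach_lattice"
  by (auto simp: lmod_def)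

lemma norm_le_norm_lmod: "lmod x \<le> lmod y \<Longrightarrow> norm x \<le> norm y" for x :: "'a::banach_lattice"
  unfolding lmod_def by (rule lattice_norm)

lemma norm_lmod: "norm (lmod x) = norm x" for x :: "'a::banach_lattice"
  by (intro antisym norm_le_norm_lmod) (simp_all add: lmod_of_nonneg lmod_nonneg)

lemma norm_mono: "0 \<le> x \<Longrightarrow> x \<le> y \<Longrightarrow> norm x \<le> norm y" for x :: "'a::banach_lattice"
  by (rule norm_le_norm_lmod) (simp add: lmod_of_nonneg order_trans[of 0 x y])

lemma norm_le_of_bounds: "x \<le> y \<Longrightarrow> - x \<le> y \<Longrightarrow> norm x \<le> norm y" for x :: "'a::banach_lattice"
  by (rule norm_le_norm_lmod) (auto simp: lmod_def intro: le_supI1)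

lemma pprt_le_lmod: "pprt x \<le> lmod x" for x :: "'a::banach_lattice"
  by (simp add: pprt_def le_lmod lmod_nonneg)

lemma norm_pprt_le: "norm (pprt x) \<le> norm x" for x :: "'a::banach_lattice"
  by (rule norm_le_norm_lmod) (simp add: lmod_of_nonneg pprt_le_lmod)

lemma le_pprt: "x \<le> pprt x" for x :: "'a::banach_lattice"
  by (simp add: pprt_def)

lemma pprt_le: "x \<le> y \<Longrightarrow> 0 \<le> y \<Longrightarrow> pprt x \<le> y" for x :: "'a::banach_lattice"
  by (simp add: pprt_def)

lemma pprt_add_le: "pprt (x + y) \<le> pprt x + pprt y" for x :: "'a::banach_lattice"
  by (intro pprt_le add_mono le_pprt add_nonneg_nonneg) simp_all

lemma pprt_scaleR:
  fixes x :: "'a::banach_lattice"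
  assumes c: "0 \<le> c"
  shows "pprt (c *\<^sub>R x) = c *\<^sub>R pprt x"
proof (cases "c = 0")
  case False
  \<comment> \<open>The easy inequality for all scalars; applied with 1/c to the vector c x it gives
    the converse.\<close>
  have le: "pprt (d *\<^sub>R y) \<le> d *\<^sub>R pprt y" if "0 \<le> d" for d and y :: 'a
    by (intro pprt_le scaleR_left_mono scaleR_nonneg_nonneg le_pprt that) simp
  have "c *\<^sub>R pprt ((1/c) *\<^sub>R (c *\<^sub>R x)) \<le> c *\<^sub>R ((1/c) *\<^sub>R pprt (c *\<^sub>R x))"
    by (intro scaleR_left_mono le) (use c in simp_all)
  then have "c *\<^sub>R pprt x \<le> pprt (c *\<^sub>R x)" using False by simp
  with le[OF c] show ?thesis by (rule antisym)
qed simp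

text \<open>Reduces facts about infima to positive parts, and provides the splitting x = inf x y +
  (x - y)^+ behind the final estimate.\<close>

lemma inf_eq_diff_pprt: "inf x y = x - pprt (x - y)" for x :: "'a::banach_lattice"
proof -
  have "x - pprt (x - y) = x + inf (- (x - y)) (- 0)"
    unfolding pprt_def by (simp only: diff_sup_eq_inf)
  also have "\<dots> = inf (x + - (x - y)) (x + - 0)" by (rule add_inf_distrib_left)
  finally show ?thesis by (simp add: inf_commute)
qed

text \<open>Subadditivity of \<open>pprt\<close>, applied to (x - y) + y and with the roles
  exchanged, bounds both signs of the difference by |x - y|.\<close>

lemma norm_pprt_diff_le: "norm (pprt x - pprt y) \<le> norm (x - y)" for x :: "'a::banach_lattice"
proof -
  have le: "pprt a - pprt b \<le> pprt (a - b)" for a b :: 'a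
    using pprt_add_le[of "a - b" b] by (simp add: algebra_simps)
  have "norm (pprt x - pprt y) \<le> norm (lmod (x - y))"
  proof (rule norm_le_of_bounds)
    show "pprt x - pprt y \<le> lmod (x - y)" using le pprt_le_lmod by (rule order_trans)
    have "pprt y - pprt x \<le> lmod (y - x)" using le pprt_le_lmod by (rule order_trans)
    then show "- (pprt x - pprt y) \<le> lmod (x - y)" by (simp add: lmod_def sup_commute)
  qed
  then show ?thesis by (simp add: norm_lmod)
qed

section \<open>Norm limits, series and the Archimedean property\<close>

lemma tendsto_pprt:
  fixes g :: "'b \<Rightarrow> 'a::banach_lattice"
  assumes "(g \<longlongrightarrow> x) F"
  shows "((\<lambda>n. pprt (g n)) \<longlongrightarrow> pprt x) F"
proof -
  have "((\<lambda>n. norm (g n - x)) \<longlongrightarrow> 0) F"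
    using assms by (simp add: LIM_zero tendsto_norm_zero)
  then have "((\<lambda>n. pprt (g n) - pprt x) \<longlongrightarrow> 0) F"
    by (rule Lim_null_comparison[rotated]) (simp add: norm_pprt_diff_le)
  then show ?thesis by (rule LIM_zero_cancel)
qed

lemma tendsto_inf:
  fixes g h :: "'b \<Rightarrow> 'a::banach_lattice"
  assumes "(g \<longlongrightarrow> x) F" "(h \<longlongrightarrow> y) F"
  shows "((\<lambda>n. inf (g n) (h n)) \<longlongrightarrow> inf x y) F"
  unfolding inf_eq_diff_pprt by (intro tendsto_intros tendsto_pprt assms)

text \<open>Positive parts are norm continuous, and those of - g n are eventually 0.\<close>

lemma LIMSEQ_nonneg:
  fixes g :: "nat \<Rightarrow> 'a::banach_lattice"
  assumes lim: "g \<longlonglongrightarrow> x" and ev: "eventually (\<lambda>n. 0 \<le> g n) sequentially"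
  shows "0 \<le> x"
proof -
  have "(\<lambda>n. pprt (- g n)) \<longlonglongrightarrow> pprt (- x)" by (intro tendsto_pprt tendsto_minus lim)
  moreover have "(\<lambda>n. pprt (- g n)) \<longlonglongrightarrow> 0"
    by (rule tendsto_eventually) (use ev in eventually_elim, simp)
  ultimately have "pprt (- x) = 0" by (rule LIMSEQ_unique)
  then show ?thesis using le_pprt[of "- x"] by simp
qed

lemma LIMSEQ_le_upper:
  fixes g :: "nat \<Rightarrow> 'a::banach_lattice"
  assumes "g \<longlonglongrightarrow> x" and "eventually (\<lambda>n. g n \<le> y) sequentially"
  shows "x \<le> y"
proof -
  have "0 \<le> y - x"
  proof (rule LIMSEQ_nonneg)
    show "(\<lambda>n. y - g n) \<longlonglongrightarrow> y - x" by (intro tendsto_intros assms)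
    show "eventually (\<lambda>n. 0 \<le> y - g n) sequentially" using assms(2) by simp
  qed
  then show ?thesis by simp
qed

lemma term_le_sum:
  fixes x :: "'b \<Rightarrow> 'a::banach_lattice"
  assumes "finite A" "i \<in> A" "\<And>j. 0 \<le> x j"
  shows "x i \<le> sum x A"
  using assms by (simp add: sum.remove[of A i x] sum_nonneg)

lemma term_le_suminf:
  fixes x :: "nat \<Rightarrow> 'a::banach_lattice"
  assumes "summable x" and nonneg: "\<And>i. 0 \<le> x i"
  shows "x n \<le> suminf x"
proof -
  have "0 \<le> suminf x - x n"
  proof (rule LIMSEQ_nonneg)
    show "(\<lambda>N. sum x {..<N} - x n) \<longlonglongrightarrow> suminf x - x n"
      by (intro tendsto_intros summable_LIMSEQ assms)
    show "eventually (\<lambda>N. 0 \<le> sum x {..<N} - x n) sequentially"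
      using eventually_gt_at_top[of n]
      by eventually_elim (simp add: term_le_sum nonneg)
  qed
  then show ?thesis by simp
qed

text \<open>Passing to positive parts and norms, m times the norm of \<open>pprt l\<close> stays
  below the norm of \<open>pprt w\<close> for every m.\<close>

lemma archimedean_nonpos:
  fixes l w :: "'a::banach_lattice"
  assumes le: "\<And>m::nat. real m *\<^sub>R l \<le> w"
  shows "l \<le> 0"
proof -
  have "norm (pprt l) \<le> inverse (real (Suc m)) * norm (pprt w)" for m
  proof -
    have "real (Suc m) *\<^sub>R pprt l \<le> pprt w"
      using pprt_mono[OF le[of "Suc m"]] by (simp only: pprt_scaleR of_nat_0_le_iff)
    then have "norm (real (Suc m) *\<^sub>R pprt l) \<le> norm (pprt w)"
      by (intro norm_mono scaleR_nonneg_nonneg) simp_all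
    then have "real (Suc m) * norm (pprt l) \<le> norm (pprt w)"
      by (simp only: norm_scaleR abs_of_nat)
    then show ?thesis by (simp add: field_simps)
  qed
  moreover have "(\<lambda>m. inverse (real (Suc m)) * norm (pprt w)) \<longlonglongrightarrow> 0"
    using tendsto_mult_left_zero[OF LIMSEQ_inverse_real_of_nat] .
  ultimately have "(\<lambda>m. pprt l) \<longlonglongrightarrow> 0"
    by (intro Lim_null_comparison[of "\<lambda>m. pprt l"]) auto
  then have "pprt l = 0" by (simp add: LIMSEQ_const_iff)
  then show ?thesis using le_pprt[of l] by simp
qed

section \<open>Disjoint elements\<close>

lemma inf_pprt_pprt_uminus: "inf (pprt z) (pprt (- z)) = 0" for z :: "'a::banach_lattice"
proof -
  have "pprt z - pprt (- z) = z" using prts[of z] by (simp add: pprt_neg)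
  then show ?thesis by (simp add: inf_eq_diff_pprt)
qed

text \<open>The criterion behind both disjoint sequences built below: elements controlled by
  opposite parts of one z inherit the disjointness of these parts.\<close>

lemma disjoint_if_le_opposite_parts:
  fixes p q z :: "'a::banach_lattice"
  assumes p: "0 \<le> p" "p \<le> c *\<^sub>R pprt z" and q: "0 \<le> q" "q \<le> pprt (- z)"
  shows "inf p q = 0"
proof (rule antisym)
  \<comment> \<open>As d >= 1 and d >= c, both bounds pass to the opposite parts of the single
    element d z.\<close>
  define d where "d = max 1 c"
  have d: "1 \<le> d" "c \<le> d" by (simp_all add: d_def)
  have "pprt (d *\<^sub>R z) = d *\<^sub>R pprt z" "pprt (- (d *\<^sub>R z)) = d *\<^sub>R pprt (- z)"
    using pprt_scaleR[of d z] pprt_scaleR[of d "- z"] d by simp_all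
  moreover have "p \<le> d *\<^sub>R pprt z"
    using p(2) by (rule order_trans) (intro scaleR_right_mono d, simp)
  moreover have "q \<le> d *\<^sub>R pprt (- z)"
    using order_trans[OF q(2)] scaleR_right_mono[OF d(1), of "pprt (- z)"] by simp
  ultimately have "inf p q \<le> inf (pprt (d *\<^sub>R z)) (pprt (- (d *\<^sub>R z)))"
    by (intro inf_mono) (simp_all only:)
  then show "inf p q \<le> 0" by (simp only: inf_pprt_pprt_uminus)
  show "0 \<le> inf p q" using p q by simp
qed

text \<open>Expanding the right-hand side gives the infimum of a + b, a + c, c + b and c + c, each
  of which is above the left-hand side.\<close>

lemma inf_add_le:
  fixes a b c :: "'a::banach_lattice"
  assumes "0 \<le> a" "0 \<le> b" "0 \<le> c"
  shows "inf (a + b) c \<le> inf a c + inf b c"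
proof -
  have "inf (a + b) c \<le> c + c" using assms by (intro le_infI2) simp
  then show ?thesis using assms
    unfolding add_inf_distrib_left add_inf_distrib_right
    by (auto intro: le_infI1 le_infI2 simp: add_increasing add_increasing2)
qed

text \<open>Disjoint positive elements add up to their supremum, which u bounds.\<close>

lemma sum_disjoint_le:
  fixes w :: "nat \<Rightarrow> 'a::banach_lattice"
  assumes nonneg: "\<And>k. 0 \<le> w k" and le: "\<And>k. w k \<le> u"
    and disj: "\<And>k n. k < n \<Longrightarrow> inf (w k) (w n) = 0"
  shows "(\<Sum>k<n. w k) \<le> u"
proof (induction n)
  case 0
  show ?case using nonneg[of 0] le[of 0] by simp
next
  case (Suc n)
  have "inf (\<Sum>k<m. w k) (w n) \<le> 0" if "m \<le> n" for m
    using that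
  proof (induction m)
    case 0
    show ?case by simp
  next
    case (Suc m)
    have "inf (sum w {..<m} + w m) (w n) \<le> inf (sum w {..<m}) (w n) + inf (w m) (w n)"
      by (intro inf_add_le nonneg sum_nonneg)
    also have "\<dots> \<le> 0" using Suc disj[of m n] by simp
    finally show ?case by simp
  qed
  \<comment> \<open>Uses a + b = inf a b + sup a b, where the infimum is at most 0.\<close>
  then have "sum w {..<n} + w n \<le> sup (sum w {..<n}) (w n)"
    unfolding add_eq_inf_sup[of "sum w {..<n}"] by simp
  also have "\<dots> \<le> u" using Suc le by simp
  finally show ?case by simp
qed

text \<open>Domination by the norm of the positive part forces positivity: for x >= 0 the bound at -
  x is 0.\<close>

lemma exists_positive_norming_functional:
  fixes y :: "'a::banach_lattice"
  assumes y: "0 \<le> y"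
  shows "\<exists>f. bounded_linear f \<and> (\<forall>x. 0 \<le> x \<longrightarrow> 0 \<le> f x) \<and> (\<forall>x. f x \<le> norm x) \<and> f y = norm y"
proof -
  have "sublinear (\<lambda>x::'a. norm (pprt x))" unfolding sublinear_def
  proof (intro conjI allI impI)
    fix x z :: 'a
    have "norm (pprt (x + z)) \<le> norm (pprt x + pprt z)" by (intro norm_mono pprt_add_le) simp
    then show "norm (pprt (x + z)) \<le> norm (pprt x) + norm (pprt z)"
      using norm_triangle_ineq order_trans by blast
  qed (simp add: pprt_scaleR)
  then obtain f where f: "linear f" "\<And>x. f x \<le> norm (pprt x)" "f y = norm (pprt y)"
    using exists_linear_support_sublinear by blast
  have le: "f x \<le> norm x" for x using f(2) norm_pprt_le by (rule order_trans)
  have "bounded_linear f"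
  proof (rule bounded_linear_intro[where K = 1])
    show "f (x + z) = f x + f z" for x z by (rule linear_add[OF f(1)])
    show "f (c *\<^sub>R x) = c *\<^sub>R f x" for c x by (rule linear_scale[OF f(1)])
    show "norm (f x) \<le> norm x * 1" for x
      using le[of x] le[of "- x"] linear_neg[OF f(1), of x] by simp
  qed
  moreover have "0 \<le> f x" if "0 \<le> x" for x
    using f(2)[of "- x"] linear_neg[OF f(1), of x] that by simp
  ultimately show ?thesis using le f(3) y by auto
qed

section \<open>Disjoint sequences and order continuous norms\<close>

lemma order_continuous_Cauchy_incseq:
  fixes s :: "nat \<Rightarrow> 'a::banach_lattice"
  assumes oc: "order_continuous TYPE('a)" and mono: "incseq s" and bdd: "\<And>n. s n \<le> u"
  shows "Cauchy s"
proof (rule metric_CauchyI)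
  fix e :: real assume e: "0 < e"
  define D where "D = {v - s n | v n. \<forall>m. s m \<le> v}"
  have "\<exists>x\<in>D. norm x < e/2"
  proof (rule oc[unfolded order_continuous_def, rule_format])
    show "D \<noteq> {}" using bdd by (auto simp: D_def)
    show "0 \<le> x" if "x \<in> D" for x using that by (auto simp: D_def)
    show "\<exists>z\<in>D. z \<le> x \<and> z \<le> y" if xy: "x \<in> D" "y \<in> D" for x y
    proof -
      obtain v n v' n' where *: "x = v - s n" "\<forall>m. s m \<le> v" "y = v' - s n'" "\<forall>m. s m \<le> v'"
        using xy by (auto simp: D_def)
      have "inf v v' - s (max n n') \<in> D" using * by (auto simp: D_def)
      moreover have "inf v v' - s (max n n') \<le> x" "inf v v' - s (max n n') \<le> y"
        unfolding * by (intro diff_mono inf_le1 inf_le2 incseqD[OF mono], simp)+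
      ultimately show ?thesis by blast
    qed
    show "l \<le> 0" if l: "\<And>x. x \<in> D \<Longrightarrow> l \<le> x" for l
    proof (rule archimedean_nonpos)
      fix k :: nat
      \<comment> \<open>If v is an upper bound of s, then l <= v - s m for all m, so v - l is an
        upper bound again. This can be iterated from u.\<close>
      have "\<forall>m. s m \<le> u - real k *\<^sub>R l"
      proof (induction k)
        case 0
        show ?case using bdd by simp
      next
        case (Suc k)
        have "l \<le> u - real k *\<^sub>R l - s m" for m
          by (rule l) (use Suc in \<open>auto simp: D_def\<close>)
        then show ?case by (auto simp: algebra_simps)
      qed
      then show "real k *\<^sub>R l \<le> u - s 0" by (simp add: algebra_simps)
    qed
    show "0 < e/2" using e by simp
  qed
  then obtain v n where vn: "\<And>m. s m \<le> v" "norm (v - s n) < e/2" by (auto simp: D_def)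
  have near: "norm (s m - s n) < e/2" if "n \<le> m" for m
  proof -
    have "norm (s m - s n) \<le> norm (v - s n)"
      by (rule norm_mono) (use vn(1) incseqD[OF mono that] in simp_all)
    then show ?thesis using vn(2) by simp
  qed
  show "\<exists>M. \<forall>m\<ge>M. \<forall>k\<ge>M. dist (s m) (s k) < e"
  proof (intro exI allI impI)
    fix m k assume "n \<le> m" "n \<le> k"
    then have "dist (s m) (s n) < e/2" "dist (s k) (s n) < e/2"
      using near by (simp_all add: dist_norm)
    then show "dist (s m) (s k) < e" by (rule dist_triangle_half_l)
  qed
qed

text \<open>By disjointness all partial sums stay below u, so the series converges and its terms
  tend to 0.\<close>

lemma order_continuous_disjoint_tendsto_0:
  fixes w :: "nat \<Rightarrow> 'a::banach_lattice"
  assumes oc: "order_continuous TYPE('a)"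
    and nonneg: "\<And>k. 0 \<le> w k" and le: "\<And>k. w k \<le> u"
    and disj: "\<And>k n. k < n \<Longrightarrow> inf (w k) (w n) = 0"
  shows "w \<longlonglongrightarrow> 0"
proof -
  have "Cauchy (\<lambda>n. \<Sum>k<n. w k)"
    using sum_disjoint_le[OF nonneg le disj]
    by (intro order_continuous_Cauchy_incseq[OF oc] incseq_SucI) (auto simp: nonneg)
  then have "summable w" by (simp add: summable_iff_convergent Cauchy_convergent_iff)
  then show ?thesis by (rule summable_LIMSEQ_zero)
qed

lemma order_continuous_weakly_null_tendsto_0:
  fixes y :: "nat \<Rightarrow> 'a::banach_lattice"
  assumes oc: "order_continuous TYPE('a)"
    and nonneg: "\<And>n. 0 \<le> y n" and le: "\<And>n. y n \<le> u" and weak: "weakly_null y"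
  shows "y \<longlonglongrightarrow> 0"
proof (rule ccontr)
  assume "\<not> y \<longlonglongrightarrow> 0"
  then obtain e where e: "0 < e" and "\<not> eventually (\<lambda>n. norm (y n) < e) sequentially"
    by (auto simp: tendsto_iff)
  then have freq: "\<exists>\<^sub>F n in sequentially. e \<le> norm (y n)" by (simp add: not_eventually not_less)
  have "\<forall>k. \<exists>f. bounded_linear f \<and> (\<forall>x. 0 \<le> x \<longrightarrow> 0 \<le> f x) \<and> (\<forall>x. f x \<le> norm x)
      \<and> f (y k) = norm (y k)"
    using exists_positive_norming_functional[OF nonneg] by blast
  then obtain f where f_lin: "\<And>k. bounded_linear (f k)"
    and f_nonneg: "\<And>k x. 0 \<le> x \<Longrightarrow> 0 \<le> f k x" and f_le: "\<And>k x. f k x \<le> norm x"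
    and f_y: "\<And>k. f k (y k) = norm (y k)"
    by metis
  interpret f: bounded_linear "f k" for k by (rule f_lin)
  \<comment> \<open>Small enough that f (d u) <= e/4 for every f dominated by the norm; the + 1
    keeps the denominator positive when u = 0.\<close>
  define d where "d = e / (4 * (norm u + 1))"
  have d: "0 < d" "d * norm u \<le> e/4"
    using e by (simp_all add: d_def field_simps add_pos_nonneg)
  \<comment> \<open>Tuned so that the later terms, after division by d, contribute at most e/4 in
    total.\<close>
  define \<eta> where "\<eta> n = d * (e/4) * (1/2)^(n+1)" for n :: nat
  have \<eta>: "0 < \<eta> n" for n using d e by (simp add: \<eta>_def)
  have "\<exists>r. \<forall>n. e \<le> norm (y (r n)) \<and> (\<forall>k<n. f (r k) (y (r n)) \<le> \<eta> n)"
  proof (rule dependent_wellorder_choice)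
    fix g :: "nat \<Rightarrow> nat" and n
    \<comment> \<open>Weak nullity makes the finitely many functionals chosen so far small on all
      late terms, and terms of norm at least e occur arbitrarily late.\<close>
    have "\<forall>k\<in>{..<n}. eventually (\<lambda>i. f (g k) (y i) < \<eta> n) sequentially"
      using weak f_lin \<eta> by (auto simp: weakly_null_def intro: order_tendstoD(2)[where y = 0])
    then have "eventually (\<lambda>i. \<forall>k\<in>{..<n}. f (g k) (y i) < \<eta> n) sequentially"
      by (rule eventually_ball_finite[OF finite_lessThan])
    from frequently_ex[OF frequently_eventually_conj[OF freq this]]
    show "\<exists>i. e \<le> norm (y i) \<and> (\<forall>k<n. f (g k) (y i) \<le> \<eta> n)"
      by (force intro: less_imp_le)
  next
    fix g h :: "nat \<Rightarrow> nat" and n i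
    assume "\<And>k. k < n \<Longrightarrow> g k = h k"
    then show "(e \<le> norm (y i) \<and> (\<forall>k<n. f (g k) (y i) \<le> \<eta> n)) =
        (e \<le> norm (y i) \<and> (\<forall>k<n. f (h k) (y i) \<le> \<eta> n))" by metis
  qed
  then obtain r where r: "\<forall>n. e \<le> norm (y (r n)) \<and> (\<forall>k<n. f (r k) (y (r n)) \<le> \<eta> n)" ..
  have r_norm: "e \<le> norm (y (r n))" for n using r by simp
  have r_small: "f (r k) (y (r n)) \<le> \<eta> n" if "k < n" for k n using r that by simp
  \<comment> \<open>Subtracting the infinite sum of all later terms would give disjointness at once, but that
    series need not converge; the truncations decrease in N, so order continuity supplies
    their limit.\<close>
  define v where "v k N = pprt (y (r k) - (\<Sum>n\<in>{k<..<N}. (1/d) *\<^sub>R y (r n)) - d *\<^sub>R u)" for k N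
  have u: "0 \<le> u" using nonneg le by (rule order_trans)
  have v_nonneg: "0 \<le> v k N" for k N by (simp add: v_def)
  have sums: "0 \<le> (\<Sum>n\<in>A. (1/d) *\<^sub>R y (r n))" for A
    using d by (intro sum_nonneg scaleR_nonneg_nonneg nonneg) simp
  have du: "0 \<le> d *\<^sub>R u" using d u by (simp add: scaleR_nonneg_nonneg)
  have v_le: "v k N \<le> pprt (y (r k) - d *\<^sub>R u)" for k N
    unfolding v_def using sums[of "{k<..<N}"] by (intro pprt_mono) simp
  have v_le_u: "v k N \<le> u" for k N
  proof -
    have "pprt (y (r k) - d *\<^sub>R u) \<le> u"
      using le[of "r k"] du u by (intro pprt_le) (simp_all add: add_increasing2 diff_le_eq)
    then show ?thesis using v_le order_trans by blast
  qed
  have v_anti: "v k N' \<le> v k N" if "N \<le> N'" for k N N'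
    unfolding v_def using that d
    by (intro pprt_mono diff_mono order_refl sum_mono2 scaleR_nonneg_nonneg nonneg) auto
  \<comment> \<open>For k < n < N the term y (r n) occurs in the sum, and y (r k) <= u. The
    resulting bound uses the part opposite to the one that bounds \<open>v n N\<close> in
    \<open>v_le\<close>.\<close>
  have v_le': "v k N \<le> (1/d) *\<^sub>R pprt (d *\<^sub>R u - y (r n))" if kn: "k < n" "n < N" for k n N
  proof -
    have "(1/d) *\<^sub>R y (r n) \<le> (\<Sum>n\<in>{k<..<N}. (1/d) *\<^sub>R y (r n))"
      using kn d by (intro term_le_sum scaleR_nonneg_nonneg nonneg) auto
    then have "y (r k) - (\<Sum>n\<in>{k<..<N}. (1/d) *\<^sub>R y (r n)) - d *\<^sub>R u \<le> u - (1/d) *\<^sub>R y (r n) - 0"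
      by (intro diff_mono le du)
    also have "\<dots> = (1/d) *\<^sub>R (d *\<^sub>R u - y (r n))" using d by (simp add: algebra_simps)
    finally have "v k N \<le> pprt ((1/d) *\<^sub>R (d *\<^sub>R u - y (r n)))"
      unfolding v_def by (rule pprt_mono)
    then show ?thesis using d by (simp add: pprt_scaleR)
  qed
  \<comment> \<open>Test with f (r k): it is at least e on y (r k), at most e/4 on the subtracted
    sum and at most e/4 on d u.\<close>
  have v_norm: "e/2 \<le> norm (v k N)" for k N
  proof -
    have "(\<Sum>n\<in>{k<..<N}. (1/d) * f (r k) (y (r n))) \<le> (\<Sum>n\<in>{k<..<N}. (e/4) * (1/2)^(n+1))"
    proof (rule sum_mono)
      fix n assume "n \<in> {k<..<N}"
      then have "f (r k) (y (r n)) \<le> d * ((e/4) * (1/2)^(n+1))"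
        using r_small[of k n] by (simp add: \<eta>_def mult.assoc)
      then show "(1/d) * f (r k) (y (r n)) \<le> (e/4) * (1/2)^(n+1)"
        using d by (simp add: field_simps)
    qed
    also have "\<dots> \<le> (\<Sum>n<N. (e/4) * (1/2)^(n+1))"
      by (rule sum_mono2) (use e in auto)
    also have "\<dots> = (e/4) * (1 - (1/2)^N)"
      by (induction N) (simp_all add: field_simps)
    also have "\<dots> \<le> e/4" using e by simp
    finally have small: "(\<Sum>n\<in>{k<..<N}. (1/d) * f (r k) (y (r n))) \<le> e/4" .
    have "d * f (r k) u \<le> e/4"
      using f_le[of "r k" u] d by (smt (verit) mult_left_mono)
    with small have "e/2 \<le> f (r k) (y (r k)) - (\<Sum>n\<in>{k<..<N}. (1/d) * f (r k) (y (r n))) - d * f (r k) u"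
      using r_norm[of k] f_y[of "r k"] by simp
    also have "\<dots> = f (r k) (y (r k) - (\<Sum>n\<in>{k<..<N}. (1/d) *\<^sub>R y (r n)) - d *\<^sub>R u)"
      by (simp add: f.diff f.sum f.scaleR)
    also have "\<dots> \<le> f (r k) (v k N)"
      using f_nonneg[of "v k N - (y (r k) - (\<Sum>n\<in>{k<..<N}. (1/d) *\<^sub>R y (r n)) - d *\<^sub>R u)" "r k"]
        le_pprt[of "y (r k) - (\<Sum>n\<in>{k<..<N}. (1/d) *\<^sub>R y (r n)) - d *\<^sub>R u"]
      by (simp add: f.diff v_def)
    also have "\<dots> \<le> norm (v k N)" by (rule f_le)
    finally show ?thesis .
  qed
  have "convergent (v k)" for k
  proof -
    \<comment> \<open>The negated sequence is increasing and bounded above by 0.\<close>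
    have "Cauchy (\<lambda>N. - v k N)"
      by (rule order_continuous_Cauchy_incseq[OF oc, where u = 0])
        (auto simp: incseq_def v_anti v_nonneg)
    then have "convergent (\<lambda>N. - v k N)" by (simp add: Cauchy_convergent_iff)
    then show ?thesis by (simp add: convergent_minus_iff[symmetric])
  qed
  then obtain w where w: "\<And>k. v k \<longlonglongrightarrow> w k" unfolding convergent_def by metis
  have "w \<longlonglongrightarrow> 0"
  proof (rule order_continuous_disjoint_tendsto_0[OF oc])
    show "0 \<le> w k" for k using w by (rule LIMSEQ_nonneg) (simp add: v_nonneg)
    show "w k \<le> u" for k using w by (rule LIMSEQ_le_upper) (simp add: v_le_u)
    fix k n :: nat assume kn: "k < n"
    have "(\<lambda>N. inf (v k N) (v n N)) \<longlonglongrightarrow> inf (w k) (w n)" by (intro tendsto_inf w)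
    \<comment> \<open>Once N > n, the two truncations are controlled by opposite parts of d u - y (r
      n); their disjointness then survives the limit.\<close>
    moreover have "eventually (\<lambda>N. inf (v k N) (v n N) = 0) sequentially"
      using eventually_gt_at_top[of n]
    proof eventually_elim
      case (elim N)
      show ?case
      proof (rule disjoint_if_le_opposite_parts)
        show "v k N \<le> (1/d) *\<^sub>R pprt (d *\<^sub>R u - y (r n))" by (rule v_le'[OF kn elim])
        show "v n N \<le> pprt (- (d *\<^sub>R u - y (r n)))" using v_le[of n N] by simp
      qed (rule v_nonneg)+
    qed
    then have "(\<lambda>N. inf (v k N) (v n N)) \<longlonglongrightarrow> 0" by (rule tendsto_eventually)
    ultimately show "inf (w k) (w n) = 0" by (rule LIMSEQ_unique)
  qed
  then have w_lim: "(\<lambda>k. norm (w k)) \<longlonglongrightarrow> 0" by (rule tendsto_norm_zero)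
  have "e/2 \<le> norm (w k)" for k
    using tendsto_norm[OF w[of k]] by (rule LIMSEQ_le_const) (use v_norm in blast)
  then have "e/2 \<le> 0" using LIMSEQ_le_const[OF w_lim] by blast
  then show False using e by simp
qed

section \<open>Positive and M-weakly compact operators\<close>

lemma positive_operator_mono:
  assumes "bounded_linear T" "positive_operator T" "x \<le> y"
  shows "T x \<le> T y"
proof -
  interpret bounded_linear T by fact
  have "0 \<le> T (y - x)" using assms by (simp add: positive_operator_def)
  then show ?thesis by (simp add: diff)
qed

lemma M_weakly_compact_uniformly_small_outside:
  fixes T :: "'a::banach_lattice \<Rightarrow> 'b::banach_lattice"
  assumes M: "M_weakly_compact T" and pos: "positive_operator T"
    and A_nonneg: "\<And>x. x \<in> A \<Longrightarrow> 0 \<le> x" and A_bdd: "\<And>x. x \<in> A \<Longrightarrow> norm x \<le> C"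
    and e: "0 < e"
  shows "\<exists>u\<ge>0. \<forall>x\<in>A. norm (T (pprt (x - u))) \<le> e"
proof (rule ccontr)
  assume "\<not> ?thesis"
  then have ex: "\<exists>x\<in>A. e < norm (T (pprt (x - u)))" if "0 \<le> u" for u
    using that by (auto simp: not_le)
  have lin: "bounded_linear T" using M by (simp add: M_weakly_compact_def)
  interpret T: bounded_linear T by (rule lin)
  \<comment> \<open>Every u >= 0 fails, so the next term is chosen against u = 4^n times the sum of
    its predecessors. The factor 4^n compensates the weights (1/2)^m and (1/2)^n, m < n, that enter
    through y.\<close>
  have "\<exists>x. \<forall>n. x n \<in> A \<and> e < norm (T (pprt (x n - 4^n *\<^sub>R (\<Sum>i<n. x i))))"
  proof (rule dependent_wellorder_choice)
    fix f g :: "nat \<Rightarrow> 'a" and n x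
    assume "\<And>y. y < n \<Longrightarrow> f y = g y"
    then have "sum f {..<n} = sum g {..<n}" by (intro sum.cong) auto
    then show "(x \<in> A \<and> e < norm (T (pprt (x - 4^n *\<^sub>R sum f {..<n})))) =
        (x \<in> A \<and> e < norm (T (pprt (x - 4^n *\<^sub>R sum g {..<n}))))" by simp
  next
    fix n and f :: "nat \<Rightarrow> 'a"
    assume "\<And>i. i < n \<Longrightarrow> f i \<in> A \<and> e < norm (T (pprt (f i - 4^i *\<^sub>R (\<Sum>j<i. f j))))"
    then have "0 \<le> 4^n *\<^sub>R sum f {..<n}"
      by (intro scaleR_nonneg_nonneg sum_nonneg) (auto intro: A_nonneg)
    from ex[OF this] show "\<exists>x. x \<in> A \<and> e < norm (T (pprt (x - 4^n *\<^sub>R sum f {..<n})))" by blast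
  qed
  then obtain x where xA: "\<And>n. x n \<in> A"
    and large: "\<And>n. e < norm (T (pprt (x n - 4^n *\<^sub>R (\<Sum>i<n. x i))))"
    by blast
  have x: "0 \<le> x n" "norm (x n) \<le> C" for n using xA A_nonneg A_bdd by auto
  \<comment> \<open>The weights make the series absolutely convergent while (1/2)^n x n stays below
    y for every n.\<close>
  define y where "y = (\<Sum>n. (1/2)^n *\<^sub>R x n)"
  have "summable (\<lambda>n. (1/2)^n *\<^sub>R x n)"
  proof (rule summable_comparison_test')
    show "summable (\<lambda>n. (1/2::real)^n * C)" by (intro summable_mult2 summable_geometric) simp
    show "norm ((1/2)^n *\<^sub>R x n) \<le> (1/2)^n * C" for n
      using x(2)[of n] by (simp add: mult_left_mono power_divide divide_right_mono)
  qed
  then have y_ge: "(1/2)^n *\<^sub>R x n \<le> y" for n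
    unfolding y_def by (rule term_le_suminf) (simp add: scaleR_nonneg_nonneg x)
  have y: "0 \<le> y" using y_ge[of 0] x(1)[of 0] by simp
  \<comment> \<open>Subtracting (1/2)^n y, which dominates a multiple of every later term, makes the
    sequence disjoint; the image of the subtracted part tends to 0.\<close>
  define w where "w n = pprt (x n - 4^n *\<^sub>R (\<Sum>i<n. x i) - (1/2)^n *\<^sub>R y)" for n
  have w_nonneg: "0 \<le> w n" for n by (simp add: w_def)
  have sums: "0 \<le> 4^n *\<^sub>R (\<Sum>i<n. x i)" for n
    by (intro scaleR_nonneg_nonneg sum_nonneg x) simp
  have hy: "0 \<le> (1/2)^n *\<^sub>R y" for n using y by (simp add: scaleR_nonneg_nonneg)
  have w_le: "w n \<le> x n" for n
  proof -
    have "x n - 4^n *\<^sub>R (\<Sum>i<n. x i) - (1/2)^n *\<^sub>R y \<le> x n - 0 - 0"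
      by (intro diff_mono order_refl sums hy)
    then show ?thesis unfolding w_def by (intro pprt_le x) simp
  qed
  \<comment> \<open>Let z = 4^n x m - x n. The sum subtracted in w n contains x m, which puts w n
    below the positive part of - z; the multiple of y subtracted in w m puts w m below (1/4)^n times
    the positive part of z.\<close>
  have disj: "inf (w m) (w n) = 0" if mn: "m < n" for m n
  proof (rule disjoint_if_le_opposite_parts[OF w_nonneg _ w_nonneg])
    have "4^n *\<^sub>R x m \<le> 4^n *\<^sub>R (\<Sum>i<n. x i)"
      using mn by (intro scaleR_left_mono term_le_sum x) auto
    then have "x n - 4^n *\<^sub>R (\<Sum>i<n. x i) - (1/2)^n *\<^sub>R y \<le> x n - 4^n *\<^sub>R x m - 0"
      by (intro diff_mono order_refl hy)
    then show "w n \<le> pprt (- (4^n *\<^sub>R x m - x n))"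
      unfolding w_def by (intro pprt_mono) simp
    \<comment> \<open>The aim is (1/4)^n x n <= (1/2)^m y, the latter being subtracted in w
      m.\<close>
    have "(1/4::real)^n = (1/2)^n * (1/2)^n" by (simp flip: power_mult_distrib)
    also have "\<dots> \<le> (1/2)^m * (1/2)^n"
      using mn by (intro mult_right_mono power_decreasing) auto
    finally have "(1/4)^n *\<^sub>R x n \<le> ((1/2)^m * (1/2)^n) *\<^sub>R x n"
      by (intro scaleR_right_mono x)
    also have "\<dots> = (1/2)^m *\<^sub>R ((1/2)^n *\<^sub>R x n)" by simp
    also have "\<dots> \<le> (1/2)^m *\<^sub>R y" by (intro scaleR_left_mono y_ge) simp
    finally have "x m - 4^m *\<^sub>R (\<Sum>i<m. x i) - (1/2)^m *\<^sub>R y \<le> x m - 0 - (1/4)^n *\<^sub>R x n"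
      by (intro diff_mono order_refl sums)
    also have "\<dots> = (1/4)^n *\<^sub>R (4^n *\<^sub>R x m - x n)"
      by (simp add: scaleR_diff_right flip: power_mult_distrib)
    finally have "w m \<le> pprt ((1/4)^n *\<^sub>R (4^n *\<^sub>R x m - x n))"
      unfolding w_def by (rule pprt_mono)
    then show "w m \<le> (1/4)^n *\<^sub>R pprt (4^n *\<^sub>R x m - x n)" by (simp add: pprt_scaleR)
  qed
  have "norm_bounded_seq w"
    unfolding norm_bounded_seq_def using norm_mono[OF w_nonneg w_le] x(2) order_trans by blast
  moreover have "disjoint_seq w"
    unfolding disjoint_seq_def
    by (metis disj inf_commute linorder_neqE_nat lmod_of_nonneg w_nonneg)
  ultimately have "(\<lambda>n. norm (T (w n))) \<longlonglongrightarrow> 0" using M by (simp add: M_weakly_compact_def)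
  moreover have "(\<lambda>n. (1/2)^n * norm (T y)) \<longlonglongrightarrow> 0"
    by (intro tendsto_mult_left_zero LIMSEQ_power_zero) simp
  ultimately have lim: "(\<lambda>n. norm (T (w n)) + (1/2)^n * norm (T y)) \<longlonglongrightarrow> 0"
    using tendsto_add by fastforce
  \<comment> \<open>The hump, whose image has norm above e, exceeds w n by at most (1/2)^n y, so the
    images of w n cannot tend to 0.\<close>
  have "e \<le> norm (T (w n)) + (1/2)^n * norm (T y)" for n
  proof -
    have "pprt (x n - 4^n *\<^sub>R (\<Sum>i<n. x i)) \<le> w n + pprt ((1/2)^n *\<^sub>R y)"
      unfolding w_def using pprt_add_le[of "x n - 4^n *\<^sub>R (\<Sum>i<n. x i) - (1/2)^n *\<^sub>R y" "(1/2)^n *\<^sub>R y"]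
      by simp
    then have "pprt (x n - 4^n *\<^sub>R (\<Sum>i<n. x i)) \<le> w n + (1/2)^n *\<^sub>R y" using hy by simp
    then have "T (pprt (x n - 4^n *\<^sub>R (\<Sum>i<n. x i))) \<le> T (w n + (1/2)^n *\<^sub>R y)"
      by (rule positive_operator_mono[OF lin pos])
    moreover have "0 \<le> T (pprt (x n - 4^n *\<^sub>R (\<Sum>i<n. x i)))"
      using pos by (simp add: positive_operator_def)
    ultimately have "norm (T (pprt (x n - 4^n *\<^sub>R (\<Sum>i<n. x i)))) \<le> norm (T (w n + (1/2)^n *\<^sub>R y))"
      by (intro norm_mono)
    also have "\<dots> \<le> norm (T (w n)) + norm (T ((1/2)^n *\<^sub>R y))"
      unfolding T.add by (rule norm_triangle_ineq)
    also have "\<dots> = norm (T (w n)) + (1/2)^n * norm (T y)"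
      by (simp add: T.scaleR)
    finally show ?thesis using large[of n] by simp
  qed
  then have "e \<le> 0" using LIMSEQ_le_const[OF lim] by blast
  then show False using e by simp
qed

lemma weakly_null_bounded_linear:
  fixes T :: "'a::real_normed_vector \<Rightarrow> 'b::real_normed_vector"
  assumes "bounded_linear T" "weakly_null x"
  shows "weakly_null (\<lambda>n. T (x n))"
  unfolding weakly_null_def
proof (intro allI impI)
  fix f :: "'b \<Rightarrow> real" assume "bounded_linear f"
  then have "bounded_linear (\<lambda>x. f (T x))" using assms(1) by (rule bounded_linear_compose)
  with assms(2)[unfolded weakly_null_def] show "(\<lambda>n. f (T (x n))) \<longlonglongrightarrow> 0" by blast
qed

theorem theorem2p16:
  fixes T :: "'a::banach_lattice \<Rightarrow> 'b::banach_lattice"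
  assumes "order_continuous TYPE('a) \<or> order_continuous TYPE('b)"
    and "bounded_linear T"
    and "positive_operator T"
    and "M_weakly_compact T"
  shows "uaw_Dunford_Pettis T"
  unfolding uaw_Dunford_Pettis_def
proof (intro conjI allI impI)
  show "bounded_linear T" by fact
  interpret T: bounded_linear T by fact
  fix x :: "nat \<Rightarrow> 'a" assume bdd: "norm_bounded_seq x" and uaw: "uaw_null x"
  obtain C where C: "\<And>n. norm (x n) \<le> C" using bdd by (auto simp: norm_bounded_seq_def)
  have truncated: "(\<lambda>n. T (inf (lmod (x n)) u)) \<longlonglongrightarrow> 0" if u: "0 \<le> u" for u
  proof -
    define y where "y n = inf (lmod (x n)) u" for n
    have y: "0 \<le> y n" "y n \<le> u" for n using u by (simp_all add: y_def lmod_nonneg)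
    have weak: "weakly_null y" using uaw u by (simp add: uaw_null_def y_def[abs_def])
    have "(\<lambda>n. T (y n)) \<longlonglongrightarrow> 0"
      using assms(1)
    proof
      assume "order_continuous TYPE('a)"
      then have "y \<longlonglongrightarrow> 0" using y weak by (rule order_continuous_weakly_null_tendsto_0)
      then show ?thesis by (rule T.tendsto_zero)
    next
      assume oc: "order_continuous TYPE('b)"
      show ?thesis
      proof (rule order_continuous_weakly_null_tendsto_0[OF oc])
        show "0 \<le> T (y n)" for n using assms(3) y by (simp add: positive_operator_def)
        show "T (y n) \<le> T u" for n by (intro positive_operator_mono[OF assms(2,3)] y)
        show "weakly_null (\<lambda>n. T (y n))" by (rule weakly_null_bounded_linear[OF assms(2) weak])
      qed
    qed
    then show ?thesis by (simp add: y_def)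
  qed
  show "(\<lambda>n. norm (T (x n))) \<longlonglongrightarrow> 0"
  proof (rule tendstoI)
    fix e :: real assume e: "0 < e"
    \<comment> \<open>Taking the whole range of the moduli as the bounded set gives one u for all
      n.\<close>
    have "\<exists>u\<ge>0. \<forall>z\<in>range (\<lambda>n. lmod (x n)). norm (T (pprt (z - u))) \<le> e/2"
      by (rule M_weakly_compact_uniformly_small_outside[OF assms(4,3)])
        (use e C in \<open>auto simp: lmod_nonneg norm_lmod\<close>)
    then obtain u where u: "0 \<le> u" and small: "\<And>n. norm (T (pprt (lmod (x n) - u))) \<le> e/2"
      by blast
    have "eventually (\<lambda>n. norm (T (inf (lmod (x n)) u)) < e/2) sequentially"
      using tendstoD[OF truncated[OF u], of "e/2"] e by simp
    then show "eventually (\<lambda>n. dist (norm (T (x n))) 0 < e) sequentially"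
    proof eventually_elim
      case (elim n)
      \<comment> \<open>For positive T both T x and - T x lie below T |x|, so x n may be replaced by
        its modulus, which is then split at u.\<close>
      have "T (x n) \<le> T (lmod (x n))" "T (- x n) \<le> T (lmod (x n))"
        by (intro positive_operator_mono[OF assms(2,3)] le_lmod neg_le_lmod)+
      then have "norm (T (x n)) \<le> norm (T (lmod (x n)))"
        by (intro norm_le_of_bounds) (simp_all add: linear_neg[OF T.linear])
      also have "lmod (x n) = inf (lmod (x n)) u + pprt (lmod (x n) - u)"
        unfolding inf_eq_diff_pprt by simp
      also have "norm (T \<dots>) \<le> norm (T (inf (lmod (x n)) u)) + norm (T (pprt (lmod (x n) - u)))"
        unfolding T.add by (rule norm_triangle_ineq)
      finally show ?case using elim small[of n] by simp
    qed
  qed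
qed

end
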